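(* For every integer $n\ge 1$, $\mathbb{R}^n$ is $2^n$-colorable with respect to the tropical metric; that is, there is a map from $\mathbb{R}^n$ to a set of $2^n$ colors such that no two points $\mathbf{x},\mathbf{y}\in\mathbb{R}^n$ with $d_{\mathrm{tr}}(\mathbf{x},\mathbf{y})=1$ have the same color.
   Context: The tropical distance between $\mathbf{x}=(x_1,\ldots,x_n)$ and $\mathbf{y}=(y_1,\ldots,y_n)$ in $\mathbb{R}^n$ is $$d_{\mathrm{tr}}(\mathbf{x},\mathbf{y}) = \max\Big\{\max_{1\le i\le n}|x_i-y_i|,\ \max_{1\le i,j\le n}(x_i-y_i-x_j+y_j)\Big\} = \max\Big\{\max_{1\le i\le n}(x_i-y_i),0\Big\}-\min\Big\{\min_{1\le i\le n}(x_i-y_i),0\Big\}.$$ No measurability or other regularity condition is imposed on the color classes. *)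

theory Defs
  imports "HOL-Analysis.Analysis"
begin

definition tropical_dist :: "real ^ 'n \<Rightarrow> real ^ 'n \<Rightarrow> real" where
  "tropical_dist x y =
     max (MAX i. \<bar>x $ i - y $ i\<bar>)
         (MAX (i, j). x $ i - y $ i - x $ j + y $ j)"

lemma tropical_dist_altdef:
  "tropical_dist x y =
     max (MAX i. x $ i - y $ i) 0 - min (MIN i. x $ i - y $ i) 0"
proof -
  define f where "f i = x $ i - y $ i" for i
  have f_le: "f i \<le> Max (range f)" and f_ge: "Min (range f) \<le> f i" for i
    by simp_all
  obtain p where p: "Max (range f) = f p"
    using Max_in[of "range f"] by (metis UNIV_not_empty finite finite_imageI image_is_empty rangeE)
  obtain q where q: "Min (range f) = f q"
    using Min_in[of "range f"] by (metis UNIV_not_empty finite finite_imageI image_is_empty rangeE)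
  have "(MAX (i, j). f i - f j) = f p - f q"
  proof (rule Max_eqI)
    fix z assume "z \<in> range (\<lambda>(i, j). f i - f j)"
    then obtain i j where "z = f i - f j" by auto
    then show "z \<le> f p - f q" using f_le[of i] f_ge[of j] p q by linarith
  next
    show "f p - f q \<in> range (\<lambda>(i, j). f i - f j)"
      by (rule image_eqI[of _ _ "(p, q)"]) auto
  qed simp
  moreover have "(MAX i. \<bar>f i\<bar>) = max \<bar>f p\<bar> \<bar>f q\<bar>"
  proof (rule Max_eqI)
    fix z assume "z \<in> range (\<lambda>i. \<bar>f i\<bar>)"
    then obtain i where "z = \<bar>f i\<bar>" by auto
    then show "z \<le> max \<bar>f p\<bar> \<bar>f q\<bar>" using f_le[of i] f_ge[of i] p q by linarith
  next
    show "max \<bar>f p\<bar> \<bar>f q\<bar> \<in> range (\<lambda>i. \<bar>f i\<bar>)"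
      by (auto simp: max_def)
  qed simp
  moreover have "f q \<le> f p" using f_le[of q] p by simp
  ultimately have "max (MAX i. \<bar>f i\<bar>) (MAX (i, j). f i - f j) =
      max (Max (range f)) 0 - min (Min (range f)) 0"
    unfolding p q by linarith
  then show ?thesis
    by (simp add: tropical_dist_def f_def algebra_simps)
qed

definition unit_dist_colorable :: "('a \<Rightarrow> 'a \<Rightarrow> real) \<Rightarrow> nat \<Rightarrow> bool" where
  "unit_dist_colorable d k \<longleftrightarrow>
     (\<exists>c :: 'a \<Rightarrow> nat. (\<forall>x. c x < k) \<and> (\<forall>x y. d x y = 1 \<longrightarrow> c x \<noteq> c y))"

end

theory Submission imports Defs begin

text \<open>
  Adjoin to \<open>x \<in> \<real>\<^sup>n\<close> an extra coordinate, equal to \<open>0\<close>. The tropical distance becomes the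
  spread \<open>max z - min z\<close> of the difference \<open>z\<close> of the extended vectors, so it is unchanged when
  a multiple of the all-ones vector is added to an extended vector. Each extended vector may
  therefore be translated to have coordinate sum \<open>0\<close>, and we scale it by \<open>2\<close>, so that
  the forbidden spread becomes \<open>2\<close>.

  In the sum-zero hyperplane the set of vectors of spread at most \<open>1\<close> is the Voronoi cell of the
  root lattice \<open>A\<^sub>n\<close> of integer vectors with sum \<open>0\<close>, so its lattice translates tile the
  hyperplane. Colour a point by the class modulo \<open>2A\<^sub>n\<close> of the lattice point whose tile contains
  it; there are \<open>2\<^sup>n\<close> classes, since the parity of the extra coordinate is determined by the
  parities of the others. Away from the boundary this is clearly correct: a difference of two
  points of one tile has spread less than \<open>2\<close>, while the difference of points of two tiles
  whose centres differ by \<open>2\<mu> \<noteq> 0\<close> has spread greater than \<open>2\<close>, because \<open>\<mu>\<close> has a coordinate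
  at least \<open>1\<close> and another at most \<open>-1\<close>.

  The difficulty is at the boundary of the cell, where ties are broken by a fixed linear order of
  the coordinates: \<open>r\<^sub>i - r\<^sub>j = 1\<close> is allowed only if \<open>i\<close> precedes \<open>j\<close>. The translates of
  this smaller cell still cover the hyperplane (lemma \<open>ex_half_open_cell\<close>), and a spread of
  exactly \<open>2\<close> would require both that \<open>i\<close> precedes \<open>j\<close> and that \<open>j\<close> precedes \<open>i\<close>
  (lemma \<open>half_open_cell_spread\<close>).
\<close>

text \<open>
  The order of the coordinates is given by an injective ranking \<open>\<iota>\<close>. For a pair \<open>i\<close>, \<open>j\<close>, at most
  one of the two opposite facets \<open>r\<^sub>i - r\<^sub>j = 1\<close> and \<open>r\<^sub>j - r\<^sub>i = 1\<close> of the Voronoi cell meets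
  the half-open cell.
\<close>

definition half_open_cell :: "('a \<Rightarrow> nat) \<Rightarrow> ('a \<Rightarrow> real) set" where
  "half_open_cell \<iota> = {r. \<forall>i j. r i - r j \<le> 1 \<and> (r i - r j = 1 \<longrightarrow> \<iota> i < \<iota> j)}"

lemma half_open_cellD:
  assumes "r \<in> half_open_cell \<iota>"
  shows "r i - r j \<le> 1" and "r i - r j = 1 \<Longrightarrow> \<iota> i < \<iota> j"
  using assms by (auto simp: half_open_cell_def)

text \<open>Removing maximal elements one at a time produces up-sets of every possible size.\<close>

lemma ex_upset_of_card:
  fixes R :: "'a \<Rightarrow> 'a \<Rightarrow> bool"
  assumes "finite A" "asymp_on A R" "transp_on A R" "totalp_on A R" "k \<le> card A"
  shows "\<exists>S\<subseteq>A. card S = k \<and> (\<forall>i\<in>S. \<forall>j\<in>A - S. R j i)"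
  using assms(5)
proof (induction k)
  case 0
  show ?case by (intro exI[of _ "{}"]) auto
next
  case (Suc k)
  then obtain S where S: "S \<subseteq> A" "card S = k" "\<forall>i\<in>S. \<forall>j\<in>A - S. R j i"
    by auto
  have "finite S" using S(1) assms(1) finite_subset by blast
  have "A - S \<noteq> {}" using S Suc.prems by auto
  moreover have "asymp_on (A - S) R" "transp_on (A - S) R"
    using assms(2,3) by (auto intro: asymp_on_subset transp_on_subset)
  ultimately obtain m where m: "m \<in> A - S" "\<forall>x\<in>A - S. x \<noteq> m \<longrightarrow> \<not> R m x"
    using Finite_Set.bex_max_element[of "A - S" R] assms(1) by auto
  have "R x m" if "x \<in> A - S" "x \<noteq> m" for x
    using m that assms(4) by (auto simp: totalp_on_def)
  then show ?case
    using S m \<open>finite S\<close> by (intro exI[of _ "insert m S"]) auto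
qed

text \<open>
  Rounding every coordinate down leaves a deficit equal to the sum \<open>k\<close> of the fractional parts.
  It is repaired by rounding up instead the \<open>k\<close> coordinates with the largest fractional parts,
  and then all residues lie in a window of length \<open>1\<close>. Both ends of the window are attained only
  when a coordinate rounded up and one rounded down have the same fractional part; the
  ranking decides which of these is rounded up.
\<close>

lemma ex_half_open_cell:
  fixes w :: "'a::finite \<Rightarrow> real"
  assumes "inj \<iota>" and "(\<Sum>i\<in>UNIV. w i) = 0"
  shows "\<exists>l :: 'a \<Rightarrow> int. sum l UNIV = (0 :: int) \<and> (\<lambda>i. w i - l i) \<in> half_open_cell \<iota>"
proof -
  define R where "R i j \<longleftrightarrow> frac (w i) < frac (w j) \<or> frac (w i) = frac (w j) \<and> \<iota> i < \<iota> j" for i j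
  define k where "k = - (\<Sum>i\<in>UNIV. \<lfloor>w i\<rfloor>)"
  have k: "real_of_int k = (\<Sum>i\<in>UNIV. frac (w i))"
    using assms(2) by (simp add: k_def frac_def sum_subtractf)
  have "0 \<le> k"
    using k sum_nonneg[of UNIV "\<lambda>i. frac (w i)"] by simp
  moreover have "(\<Sum>i\<in>UNIV. frac (w i)) \<le> (\<Sum>i\<in>(UNIV :: 'a set). 1)"
    by (intro sum_mono) (simp add: frac_lt_1 less_imp_le)
  then have "nat k \<le> card (UNIV :: 'a set)"
    using k by simp
  moreover have "asymp_on UNIV R" "transp_on UNIV R"
    by (auto simp: R_def asymp_on_def transp_on_def)
  moreover have "totalp_on UNIV R"
    using assms(1) by (auto simp: R_def totalp_on_def inj_def not_less order.order_iff_strict)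
  ultimately obtain S where S: "card S = nat k" "\<And>i j. i \<in> S \<Longrightarrow> j \<notin> S \<Longrightarrow> R j i"
    using ex_upset_of_card[of UNIV R "nat k"] by auto
  define l where "l i = \<lfloor>w i\<rfloor> + (if i \<in> S then 1 else 0)" for i
  have "sum l UNIV = 0"
    using S(1) \<open>0 \<le> k\<close> by (simp add: l_def sum.distrib k_def flip: sum.inter_filter)
  moreover have "w i - l i - (w j - l j) \<le> 1 \<and> (w i - l i - (w j - l j) = 1 \<longrightarrow> \<iota> i < \<iota> j)" for i j
  proof -
    have res: "w m - l m = frac (w m) - (if m \<in> S then 1 else 0)" for m
      by (simp add: l_def frac_def)
    have "0 \<le> frac (w i)" "frac (w i) < 1" "0 \<le> frac (w j)" "frac (w j) < 1"
      by (simp_all add: frac_lt_1)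
    then show ?thesis
      using S(2)[of j i] unfolding res R_def by (cases "i \<in> S"; cases "j \<in> S") (auto simp del: frac_ge_0)
  qed
  ultimately show ?thesis
    by (intro exI[of _ l]) (auto simp: half_open_cell_def)
qed

text \<open>
  For \<open>\<mu> = 0\<close> the spread is less than \<open>2\<close>, and for \<open>\<mu> \<noteq> 0\<close> it is greater than \<open>2\<close>. In both
  cases the weak inequality comes from the cell being contained in the vectors of spread at most
  \<open>1\<close>, and equality would place \<open>r\<close> and \<open>s\<close> on opposite facets of the cell.
\<close>

lemma half_open_cell_spread:
  fixes r s :: "'a::finite \<Rightarrow> real" and \<mu> :: "'a \<Rightarrow> int"
  assumes r: "r \<in> half_open_cell \<iota>" and s: "s \<in> half_open_cell \<iota>"
    and \<mu>: "(\<Sum>i\<in>UNIV. \<mu> i) = 0"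
    and z: "\<And>i. z i = r i - s i + 2 * of_int (\<mu> i)"
    and le: "\<And>i j. z i - z j \<le> 2"
  shows "z i - z j \<noteq> 2"
proof (cases "\<forall>i. \<mu> i = 0")
  case True
  show ?thesis
  proof
    assume "z i - z j = 2"
    then have "r i - r j = 1" "s j - s i = 1"
      using half_open_cellD(1)[OF r, of i j] half_open_cellD(1)[OF s, of j i] z True by auto
    then have "\<iota> i < \<iota> j" "\<iota> j < \<iota> i"
      using half_open_cellD(2)[OF r] half_open_cellD(2)[OF s] by auto
    then show False by simp
  qed
next
  case False
  have "\<exists>p. \<mu> p \<ge> 1"
  proof (rule ccontr)
    assume "\<not> (\<exists>p. \<mu> p \<ge> 1)"
    then have "0 \<le> - \<mu> i" for i using linorder_not_le[of 1 "\<mu> i"] by auto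
    then have "\<forall>i\<in>UNIV. - \<mu> i = 0"
      using \<mu> sum_nonneg_eq_0_iff[of UNIV "\<lambda>i. - \<mu> i"] by (simp add: sum_negf)
    with False show False by simp
  qed
  moreover have "\<exists>q. \<mu> q \<le> - 1"
  proof (rule ccontr)
    assume "\<not> (\<exists>q. \<mu> q \<le> - 1)"
    then have "0 \<le> \<mu> i" for i using linorder_not_le[of "\<mu> i" "- 1"] by auto
    then have "\<forall>i\<in>UNIV. \<mu> i = 0"
      using \<mu> sum_nonneg_eq_0_iff[of UNIV \<mu>] by simp
    with False show False by simp
  qed
  ultimately obtain p q where p: "\<mu> p \<ge> 1" and q: "\<mu> q \<le> - 1"
    by blast
  then have "real_of_int (\<mu> p) \<ge> 1" "real_of_int (\<mu> q) \<le> - 1"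
    by linarith+
  then have "r q - r p = 1" "s p - s q = 1"
    using half_open_cellD(1)[OF r, of q p] half_open_cellD(1)[OF s, of p q] le[of p q]
    unfolding z by linarith+
  then have "\<iota> q < \<iota> p" "\<iota> p < \<iota> q"
    using half_open_cellD(2)[OF r] half_open_cellD(2)[OF s] by auto
  then show ?thesis by simp
qed

definition extend_zero :: "real ^ 'n \<Rightarrow> 'n option \<Rightarrow> real" where
  "extend_zero x i = (case i of None \<Rightarrow> 0 | Some m \<Rightarrow> x $ m)"

text \<open>
  The pairs containing the extra coordinate contribute the absolute values \<open>\<bar>x\<^sub>i - y\<^sub>i\<bar>\<close>
  to the maximum, and the other pairs the differences \<open>x\<^sub>i - y\<^sub>i - x\<^sub>j + y\<^sub>j\<close>.
\<close>

lemma tropical_dist_eq_spread: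
  fixes x y :: "real ^ 'n"
  defines "z \<equiv> \<lambda>i. extend_zero x i - extend_zero y i"
  shows "tropical_dist x y = (MAX (i, j). z i - z j)"
proof (rule sym, rule Max_eqI)
  have abs_le: "\<bar>x $ i - y $ i\<bar> \<le> tropical_dist x y" for i
    unfolding tropical_dist_def by (rule max.coboundedI1) simp
  have diff_le: "x $ i - y $ i - x $ j + y $ j \<le> tropical_dist x y" for i j
    unfolding tropical_dist_def
    by (rule max.coboundedI2, rule Max_ge) (auto intro!: image_eqI[of _ _ "(i, j)"])
  fix d assume "d \<in> range (\<lambda>(i, j). z i - z j)"
  then obtain i j where d: "d = z i - z j" by auto
  have "0 \<le> tropical_dist x y"
    using abs_le[of undefined] by linarith
  then show "d \<le> tropical_dist x y"
    using abs_le diff_le unfolding d z_def extend_zero_def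
    by (cases i; cases j) (auto simp: abs_le_iff algebra_simps)
next
  have "(MAX i. \<bar>x $ i - y $ i\<bar>) \<in> range (\<lambda>i. \<bar>x $ i - y $ i\<bar>)"
    by (rule Max_in) auto
  then obtain m where m: "(MAX i. \<bar>x $ i - y $ i\<bar>) = \<bar>x $ m - y $ m\<bar>" by (rule rangeE)
  have "(MAX (i, j). x $ i - y $ i - x $ j + y $ j)
      \<in> range (\<lambda>(i, j). x $ i - y $ i - x $ j + y $ j)"
    by (rule Max_in) auto
  then obtain i j where ij: "(MAX (i, j). x $ i - y $ i - x $ j + y $ j)
      = x $ i - y $ i - x $ j + y $ j"
    unfolding image_iff by (metis (no_types, lifting) case_prod_conv surj_pair)
  have "tropical_dist x y \<in> {z (Some m) - z None, z None - z (Some m), z (Some i) - z (Some j)}"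
    unfolding tropical_dist_def m ij by (auto simp: z_def extend_zero_def max_def abs_if)
  then show "tropical_dist x y \<in> range (\<lambda>(i, j). z i - z j)"
    by (auto intro: image_eqI[of _ _ "(Some m, None)"] image_eqI[of _ _ "(None, Some m)"]
        image_eqI[of _ _ "(Some i, Some j)"])
qed simp

theorem theorem3p2:
  "unit_dist_colorable (tropical_dist :: real ^ 'n \<Rightarrow> real ^ 'n \<Rightarrow> real) (2 ^ CARD('n))"
proof -
  obtain \<iota> :: "'n option \<Rightarrow> nat" where \<iota>: "inj \<iota>"
    using finite_imp_inj_to_nat_seg[of "UNIV :: 'n option set"] by auto
  define mean :: "real ^ 'n \<Rightarrow> real"
    where "mean x = (\<Sum>i\<in>UNIV. extend_zero x i) / CARD('n option)" for x
  define w where "w x i = 2 * (extend_zero x i - mean x)" for x i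
  have "(\<Sum>i\<in>UNIV. w x i) = 0" for x
    by (simp add: w_def mean_def sum_subtractf flip: sum_distrib_left)
  then have "\<forall>x. \<exists>l :: 'n option \<Rightarrow> int.
      sum l UNIV = (0 :: int) \<and> (\<lambda>i. w x i - l i) \<in> half_open_cell \<iota>"
    using ex_half_open_cell[OF \<iota>] by blast
  then obtain l :: "real ^ 'n \<Rightarrow> 'n option \<Rightarrow> int"
    where sum_l: "\<And>x. sum (l x) UNIV = (0 :: int)"
      and cell: "\<And>x. (\<lambda>i. w x i - l x i) \<in> half_open_cell \<iota>"
    by metis
  have sum_Some: "(\<Sum>i\<in>UNIV. f i) = f None + (\<Sum>m\<in>UNIV. f (Some m))"
    for f :: "'n option \<Rightarrow> int"
    by (simp add: UNIV_option_conv sum.reindex)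
  define colour where "colour x = {m. odd (l x (Some m))}" for x
  have "tropical_dist x y \<noteq> 1" if same: "colour x = colour y" for x y
  proof
    assume dist: "tropical_dist x y = 1"
    define z where "z i = extend_zero x i - extend_zero y i" for i
    have max_z: "(MAX (i, j). z i - z j) = 1"
      using dist by (simp add: tropical_dist_eq_spread z_def)
    have z_le: "z i - z j \<le> 1" for i j
    proof -
      have "z i - z j \<le> (MAX (i, j). z i - z j)"
        by (rule Max_ge) (auto intro: image_eqI[of _ _ "(i, j)"])
      then show ?thesis using max_z by simp
    qed
    have "(MAX (i, j). z i - z j) \<in> range (\<lambda>(i, j). z i - z j)"
      by (rule Max_in) auto
    then obtain p q where pq: "z p - z q = 1"
      using max_z by auto
    define \<mu> where "\<mu> i = (l x i - l y i) div 2" for i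
    have even_Some: "even (l x (Some m) - l y (Some m))" for m
      using same by (auto simp: colour_def)
    have sum_diff: "(\<Sum>i\<in>UNIV. l x i - l y i) = 0"
      by (simp add: sum_subtractf sum_l)
    have "even (\<Sum>m\<in>UNIV. l x (Some m) - l y (Some m))"
      using even_Some by (intro dvd_sum) auto
    then have "even (l x None - l y None)"
      using sum_diff unfolding sum_Some by presburger
    then have "even (l x i - l y i)" for i
      using even_Some by (cases i) auto
    then have \<mu>: "l x i - l y i = 2 * \<mu> i" for i
      unfolding \<mu>_def by simp
    have "(\<Sum>i\<in>UNIV. \<mu> i) = 0"
      using sum_diff unfolding \<mu> by (simp flip: sum_distrib_left)
    \<comment> \<open>The centring of \<open>x\<close> and \<open>y\<close> changes \<open>2 * z\<close> by a constant vector, which cancels from all differences.\<close>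
    define z' where "z' i = 2 * z i - 2 * (mean x - mean y)" for i
    have diff_z': "z' i - z' j = 2 * (z i - z j)" for i j
      by (simp add: z'_def)
    have "z' i = (w x i - l x i) - (w y i - l y i) + 2 * of_int (\<mu> i)" for i
    proof -
      have "real_of_int (l x i) - l y i = 2 * of_int (\<mu> i)"
        using \<mu>[of i] by linarith
      then show ?thesis by (simp add: z'_def w_def z_def algebra_simps)
    qed
    moreover have "z' i - z' j \<le> 2" for i j
      using z_le[of i j] by (simp add: diff_z')
    ultimately have "z' p - z' q \<noteq> 2"
      using half_open_cell_spread[OF cell[of x] cell[of y] \<open>(\<Sum>i\<in>UNIV. \<mu> i) = 0\<close>] by blast
    with pq show False by (simp add: diff_z')
  qed
  moreover obtain code :: "'n set \<Rightarrow> nat" where code: "bij_betw code UNIV {0..<2 ^ CARD('n)}"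
    using ex_bij_betw_finite_nat[of "UNIV :: 'n set set"] card_Pow[of "UNIV :: 'n set"] by auto
  ultimately have "\<forall>x y. tropical_dist x y = 1 \<longrightarrow> code (colour x) \<noteq> code (colour y)"
    by (metis UNIV_I bij_betw_imp_inj_on inj_onD)
  moreover have "code (colour x) < 2 ^ CARD('n)" for x
    using bij_betwE[OF code] by auto
  ultimately show ?thesis
    unfolding unit_dist_colorable_def by (intro exI[of _ "\<lambda>x. code (colour x)"]) auto
qed

end
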